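(* The set $P$ of all prime numbers has the explicit representation $$P=\{2\}\cup\{3\}\cup A'\cup B',$$ where $$A'=\{\alpha_k=6k-1 : k\in\mathbb{N},\ k\neq 6ij-i+j \text{ for all } i,j\in\mathbb{N}\},$$ $$B'=\{\beta_k=6k+1 : k\in\mathbb{N},\ k\neq 6ij+i+j \text{ and } k\neq 6ij-i-j \text{ for all } i,j\in\mathbb{N}\}.$$
   Context: $\mathbb{N}=\{1,2,3,\dots\}$ denotes the set of positive integers. *)

theory Defs
  imports "HOL-Computational_Algebra.Primes"
begin

text \<open>
  The paper's positive integers are rendered as \<^typ>\<open>nat\<close> values that are at least 1. The
  conditions on the index are stated over \<^typ>\<open>int\<close>, so subtraction there is never truncated; the
  subtraction in \<open>\<alpha>\<close> is exact because its argument is at least 1 wherever it is used.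
\<close>

definition \<alpha> :: "nat \<Rightarrow> nat" where
  "\<alpha> k = 6 * k - 1"

definition \<beta> :: "nat \<Rightarrow> nat" where
  "\<beta> k = 6 * k + 1"

definition A' :: "nat set" where
  "A' = {\<alpha> k | k. k \<ge> 1 \<and>
     (\<forall>i j :: nat. i \<ge> 1 \<longrightarrow> j \<ge> 1 \<longrightarrow> int k \<noteq> 6 * int i * int j - int i + int j)}"

definition B' :: "nat set" where
  "B' = {\<beta> k | k. k \<ge> 1 \<and>
     (\<forall>i j :: nat. i \<ge> 1 \<longrightarrow> j \<ge> 1 \<longrightarrow>
        int k \<noteq> 6 * int i * int j + int i + int j \<and>
        int k \<noteq> 6 * int i * int j - int i - int j)}"

end

theory Submission
  imports Defs
begin

text \<open>
  Every prime other than 2 and 3 is coprime to 6, hence lies next to a multiple of 6. Conversely, a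
  number coprime to 6 has only divisors coprime to 6, so it is composite exactly when it is a product
  \<open>(6i + s)(6j + t)\<close> with \<open>i, j \<ge> 1\<close> and signs \<open>s, t\<close> (\<open>not_prime_iff_signed_factors\<close>). Expanding
  gives \<open>6(6ij + ti + sj) + st\<close>: the sign \<open>st\<close> decides whether the product is some \<open>6k - 1\<close> or some
  \<open>6k + 1\<close>, and then \<open>k = 6ij + ti + sj\<close>. Opposite signs give the one form excluded in the definition
  of \<open>A'\<close>, up to exchanging \<open>i\<close> and \<open>j\<close>; equal signs give the two forms excluded in that of \<open>B'\<close>.
\<close>

lemma coprime_6_next_to_multiple:
  fixes d :: nat
  assumes "d > 1" "\<not> 2 dvd d" "\<not> 3 dvd d"
  shows "\<exists>i::nat. i \<ge> 1 \<and> (\<exists>s\<in>{-1, 1}. int d = 6 * int i + s)"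
proof -
  have "d mod 6 = 1 \<or> d mod 6 = 5"
    using assms by presburger
  then show ?thesis
  proof
    assume "d mod 6 = 1"
    then have "d div 6 \<ge> 1 \<and> int d = 6 * int (d div 6) + 1"
      using assms(1) by presburger
    then show ?thesis
      by blast
  next
    assume "d mod 6 = 5"
    then have "int d = 6 * int (d div 6 + 1) + - 1"
      by presburger
    then show ?thesis
      by (metis insertI1 le_add2)
  qed
qed

lemma signed_factors_expand:
  fixes x y s t :: int
  shows "(6 * x + s) * (6 * y + t) = 6 * (6 * x * y + t * x + s * y) + s * t"
  by (simp add: algebra_simps)

text \<open>
  The bounds \<open>i, j \<ge> 1\<close> make both factors at least 5, so the factorisation is proper.
\<close>

lemma not_prime_iff_signed_factors:
  fixes n :: nat
  assumes "n > 1" "\<not> 2 dvd n" "\<not> 3 dvd n"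
  shows "\<not> prime n \<longleftrightarrow>
    (\<exists>i j :: nat. i \<ge> 1 \<and> j \<ge> 1 \<and>
       (\<exists>s\<in>{-1, 1}. \<exists>t\<in>{-1, 1}. int n = (6 * int i + s) * (6 * int j + t)))"
    (is "_ \<longleftrightarrow> ?factors")
proof
  assume "\<not> prime n"
  then obtain a where a: "a dvd n" "a \<noteq> 1" "a \<noteq> n"
    using assms(1) by (auto simp: prime_nat_iff)
  then obtain b where b: "n = a * b"
    by blast
  have "a * b \<noteq> 0"
    using b assms(1) by linarith
  moreover have "b \<noteq> 1"
    using a(3) b by simp
  ultimately have "a \<noteq> 0" "b \<noteq> 0" "b \<noteq> 1"
    by simp_all
  then have "a > 1" "b > 1"
    using a(2) by simp_all
  have "\<not> 2 dvd a" "\<not> 3 dvd a" "\<not> 2 dvd b" "\<not> 3 dvd b"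
    using assms(2,3) b by auto
  obtain i :: nat and s :: int where i: "i \<ge> 1" "s \<in> {-1, 1}" "int a = 6 * int i + s"
    using coprime_6_next_to_multiple[OF \<open>a > 1\<close> \<open>\<not> 2 dvd a\<close> \<open>\<not> 3 dvd a\<close>] by blast
  obtain j :: nat and t :: int where j: "j \<ge> 1" "t \<in> {-1, 1}" "int b = 6 * int j + t"
    using coprime_6_next_to_multiple[OF \<open>b > 1\<close> \<open>\<not> 2 dvd b\<close> \<open>\<not> 3 dvd b\<close>] by blast
  have "int n = (6 * int i + s) * (6 * int j + t)"
    by (simp only: b of_nat_mult i(3) j(3))
  then show ?factors
    using i(1,2) j(1,2) by blast
next
  assume ?factors
  then obtain i j :: nat and s t :: int
    where ij: "i \<ge> 1" "j \<ge> 1" and st: "s \<in> {-1, 1}" "t \<in> {-1, 1}"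
      and n: "int n = (6 * int i + s) * (6 * int j + t)"
    by blast
  define a b where "a = nat (6 * int i + s)" and "b = nat (6 * int j + t)"
  have "a > 1" "b > 1" "int a = 6 * int i + s" "int b = 6 * int j + t"
    using ij st by (auto simp: a_def b_def)
  moreover from this have "n = a * b"
    using n by (metis of_nat_eq_iff of_nat_mult)
  ultimately show "\<not> prime n"
    by (metis less_irrefl prime_product)
qed

lemma prime_\<alpha>_iff:
  assumes "k \<ge> 1"
  shows "prime (\<alpha> k) \<longleftrightarrow>
    (\<forall>i j :: nat. i \<ge> 1 \<longrightarrow> j \<ge> 1 \<longrightarrow> int k \<noteq> 6 * int i * int j - int i + int j)"
proof -
  have \<alpha>: "int (\<alpha> k) = 6 * int k - 1"
    using assms by (simp add: \<alpha>_def)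
  have "\<alpha> k > 1" "\<not> 2 dvd \<alpha> k" "\<not> 3 dvd \<alpha> k"
    using assms unfolding \<alpha>_def by presburger+
  note factors = not_prime_iff_signed_factors[OF this, unfolded \<alpha>]
  have residue: "6 * x - 1 \<noteq> 6 * y + 1" "6 * x - 1 = 6 * y + - 1 \<longleftrightarrow> x = y" for x y :: int
    by presburger+
  (* Equal signs are impossible here: the product would be 1 modulo 6, whereas \<alpha> k is -1. *)
  have signs: "6 * int k - 1 \<noteq> (6 * int i + 1) * (6 * int j + 1)"
    "6 * int k - 1 \<noteq> (6 * int i + - 1) * (6 * int j + - 1)"
    "6 * int k - 1 = (6 * int i + 1) * (6 * int j + - 1) \<longleftrightarrow>
       int k = 6 * int i * int j - int i + int j"
    "6 * int k - 1 = (6 * int i + - 1) * (6 * int j + 1) \<longleftrightarrow>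
       int k = 6 * int j * int i - int j + int i" for i j :: nat
    by (simp_all only: signed_factors_expand mult_1_left mult_minus1 minus_minus residue) auto
  show ?thesis
    using factors by (simp only: bex_simps signs simp_thms) blast
qed

lemma prime_\<beta>_iff:
  assumes "k \<ge> 1"
  shows "prime (\<beta> k) \<longleftrightarrow>
    (\<forall>i j :: nat. i \<ge> 1 \<longrightarrow> j \<ge> 1 \<longrightarrow>
       int k \<noteq> 6 * int i * int j + int i + int j \<and>
       int k \<noteq> 6 * int i * int j - int i - int j)"
proof -
  have \<beta>: "int (\<beta> k) = 6 * int k + 1"
    by (simp add: \<beta>_def)
  have "\<beta> k > 1" "\<not> 2 dvd \<beta> k" "\<not> 3 dvd \<beta> k"
    using assms unfolding \<beta>_def by presburger+
  note factors = not_prime_iff_signed_factors[OF this, unfolded \<beta>]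
  have residue: "6 * x + 1 \<noteq> 6 * y + - 1" "6 * x + 1 = 6 * y + 1 \<longleftrightarrow> x = y" for x y :: int
    by presburger+
  (* Opposite signs are impossible here: the product would be -1 modulo 6, whereas \<beta> k is 1. *)
  have signs: "6 * int k + 1 \<noteq> (6 * int i + 1) * (6 * int j + - 1)"
    "6 * int k + 1 \<noteq> (6 * int i + - 1) * (6 * int j + 1)"
    "6 * int k + 1 = (6 * int i + 1) * (6 * int j + 1) \<longleftrightarrow>
       int k = 6 * int i * int j + int i + int j"
    "6 * int k + 1 = (6 * int i + - 1) * (6 * int j + - 1) \<longleftrightarrow>
       int k = 6 * int i * int j - int i - int j" for i j :: nat
    by (simp_all only: signed_factors_expand mult_1_left mult_minus1 minus_minus residue) auto
  show ?thesis
    using factors by (simp only: bex_simps signs simp_thms) blast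
qed

lemma prime_is_\<alpha>_or_\<beta>:
  fixes p :: nat
  assumes "prime p" "p \<noteq> 2" "p \<noteq> 3"
  shows "\<exists>k\<ge>1. p = \<alpha> k \<or> p = \<beta> k"
proof -
  have "\<not> 2 dvd p" "\<not> 3 dvd p"
    using assms primes_dvd_imp_eq[of 2 p] primes_dvd_imp_eq[of 3 p] by auto
  then obtain k :: nat and s :: int
    where "k \<ge> 1" "s \<in> {-1, 1}" "int p = 6 * int k + s"
    using coprime_6_next_to_multiple prime_gt_1_nat[OF assms(1)] by meson
  then have "k \<ge> 1 \<and> (p = \<alpha> k \<or> p = \<beta> k)"
    by (auto simp: \<alpha>_def \<beta>_def)
  then show ?thesis
    by blast
qed

theorem theorem3: "{p :: nat. prime p} = {2} \<union> {3} \<union> A' \<union> B'"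
proof -
  have A': "A' = {\<alpha> k | k. k \<ge> 1 \<and> prime (\<alpha> k)}"
    unfolding A'_def using prime_\<alpha>_iff by blast
  have B': "B' = {\<beta> k | k. k \<ge> 1 \<and> prime (\<beta> k)}"
    unfolding B'_def using prime_\<beta>_iff by blast
  have "prime (2::nat)" "prime (3::nat)"
    by simp_all
  then show ?thesis
    unfolding A' B' using prime_is_\<alpha>_or_\<beta> by blast
qed

end
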